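(* Let $M \in \mathbb{R}^{n\times d}$ and let $S \in \mathbb{B}^{n\times d}$. Then $S$ is a type with respect to $M$ (i.e. $S$ is the type of some point $x\in\mathbb{R}^n$ with respect to $M$) if and only if all of the following hold: (T1) every column of $S$ is non-zero; (T2) every partial bijection contained in $S$ is permanent-attaining with respect to $M$; (T3) if $S$ contains a partial bijection $\sigma$, then $S$ contains every partial bijection that is permanent-attaining with respect to $M$ and has the same domain of definition and the same image as $\sigma$.
   Context: $\mathbb{B}^{n\times d}$ denotes the set of $n\times d$ Boolean ($0/1$) matrices, partially ordered entrywise: $A\preceq B$ iff $A_{ij}\le B_{ij}$ for all $i,j$. For $a,y\in\mathbb{R}^n$ and $i\in[n]=\{1,\dots,n\}$, say $a$ dominates $y$ in position $i$ if $y_i-a_i=\min_k\{y_k-a_k\}$; write $\mathrm{Dom}_i(a)=\{y\in\mathbb{R}^n : y_i-a_i=\min_k (y_k-a_k)\}$. For $M\in\mathbb{R}^{n\times d}$ with columns $M_{\star 1},\dots,M_{\star d}$, the type of $x\in\mathbb{R}^n$ with respect to $M$ is the matrix $T\in\mathbb{B}^{n\times d}$ with $T_{ij}=1$ iff $x\in\mathrm{Dom}_i(M_{\star j})$. A partial bijection $\sigma:[d]\dashrightarrow[n]$ is a bijection $\sigma:J\to I$ with $J\subseteq[d]$ (its domain of definition) and $I\subseteq[n]$ (its image); it is identified with the matrix $\Sigma\in\mathbb{B}^{n\times d}$ with $\Sigma_{ij}=1$ iff $j\in J$ and $i=\sigma(j)$, and $S$ contains $\sigma$ if $\Sigma\preceq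 S$. A partial bijection $\sigma:J\to I$ is permanent-attaining with respect to $M$ if $\sum_{j\in J}M_{\sigma(j),j}\ge\sum_{j\in J}M_{\tau(j),j}$ for every bijection $\tau:J\to I$. *)

theory Defs
  imports "HOL-Analysis.Analysis"
begin

text \<open>
  An \<open>n \<times> d\<close> matrix has type \<open>'a ^ 'd ^ 'n\<close>, with entry \<open>M $ i $ j\<close> in row \<open>i\<close> and column \<open>j\<close>.
  Boolean matrices are \<open>bool ^ 'd ^ 'n\<close>, \<open>True\<close> being 1; as \<open>False \<le> True\<close>, the library order
  on vectors is the entrywise order.
\<close>

definition Dom :: "'n::finite \<Rightarrow> real ^ 'n \<Rightarrow> (real ^ 'n) set" where
  "Dom i a = {y. y $ i - a $ i = (MIN k. y $ k - a $ k)}"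

definition type_of :: "real ^ 'd ^ 'n \<Rightarrow> real ^ 'n \<Rightarrow> bool ^ 'd ^ 'n" where
  "type_of M x = (\<chi> i j. x \<in> Dom i (column j M))"

text \<open>
  A partial bijection from columns to rows is an injective \<open>\<sigma> :: 'd \<rightharpoonup> 'n\<close>: its domain of
  definition is \<open>dom \<sigma>\<close>, its image is \<open>ran \<sigma>\<close>.
\<close>

definition partial_bijection :: "('d \<rightharpoonup> 'n) \<Rightarrow> bool" where
  "partial_bijection \<sigma> \<longleftrightarrow> inj_on \<sigma> (dom \<sigma>)"

definition pb_matrix :: "('d \<rightharpoonup> 'n) \<Rightarrow> bool ^ 'd ^ 'n" where
  "pb_matrix \<sigma> = (\<chi> i j. \<sigma> j = Some i)"

definition contains_pb :: "bool ^ 'd ^ 'n \<Rightarrow> ('d \<rightharpoonup> 'n) \<Rightarrow> bool" where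
  "contains_pb S \<sigma> \<longleftrightarrow> pb_matrix \<sigma> \<le> S"

definition permanent_attaining :: "real ^ 'd ^ 'n \<Rightarrow> ('d \<rightharpoonup> 'n) \<Rightarrow> bool" where
  "permanent_attaining M \<sigma> \<longleftrightarrow>
    (\<forall>\<tau>. bij_betw \<tau> (dom \<sigma>) (ran \<sigma>) \<longrightarrow>
      (\<Sum>j\<in>dom \<sigma>. M $ the (\<sigma> j) $ j) \<ge> (\<Sum>j\<in>dom \<sigma>. M $ \<tau> j $ j))"

end

theory Submission imports Defs begin

text \<open>
  Given (T1), a point \<open>x\<close> has type \<open>S\<close> iff, for suitable \<open>y\<^sub>j\<close>, one has \<open>x\<^sub>i \<ge> M\<^sub>i\<^sub>j + y\<^sub>j\<close> with equality exactly where
  \<open>S\<^sub>i\<^sub>j\<close> holds. Requiring a small slack \<open>e > 0\<close> elsewhere, this is a system of difference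
  constraints on the bipartite graph of rows and columns, with an edge from every column to every row
  and an edge from row \<open>i\<close> to column \<open>j\<close> where \<open>S\<^sub>i\<^sub>j\<close>. It is solvable, by longest paths, as soon as
  no cycle has positive weight. A simple cycle splits into two partial bijections with the same
  domain and image, one formed by its row-to-column edges and hence contained in \<open>S\<close>, and its weight
  is the difference of their contributions to the permanent, plus \<open>e\<close> for every edge outside \<open>S\<close>:
  (T2) and (T3) make this non-positive for small \<open>e\<close>.
\<close>

subsection \<open>Potentials on weighted digraphs\<close>

fun walk_weight :: "('v \<Rightarrow> 'v \<Rightarrow> real) \<Rightarrow> 'v list \<Rightarrow> real" where
  "walk_weight w (u # v # vs) = w u v + walk_weight w (v # vs)"
| "walk_weight w vs = 0"

lemma walk_weight_append:
  "walk_weight w (us @ v # vs) = walk_weight w (us @ [v]) + walk_weight w (v # vs)"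
  by (induction w us rule: walk_weight.induct) (auto split: list.splits)

text \<open>Turns a closed simple walk into a permutation of its vertex set, so that its weight
  becomes a sum over a set. The closing edge changes at every step of the induction, hence
  \<open>E\<close> is not claimed for it.\<close>

lemma cycle_permutation:
  assumes "distinct vs" "vs \<noteq> []" "successively E vs"
  obtains \<pi> where "bij_betw \<pi> (set vs) (set vs)" "\<pi> (last vs) = hd vs"
    "\<And>v. v \<in> set vs \<Longrightarrow> v \<noteq> last vs \<Longrightarrow> E v (\<pi> v)"
    "(\<Sum>v\<in>set vs. w v (\<pi> v)) = walk_weight w vs + w (last vs) (hd vs)"
  using assms
proof (induction w vs arbitrary: thesis rule: walk_weight.induct)
  case (1 w u v vs)
  let ?l = "last (v # vs)" and ?A = "set (v # vs)"
  obtain \<pi> where \<pi>: "bij_betw \<pi> ?A ?A" "\<pi> ?l = v"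
    "\<And>z. z \<in> ?A \<Longrightarrow> z \<noteq> ?l \<Longrightarrow> E z (\<pi> z)"
    "(\<Sum>z\<in>?A. w z (\<pi> z)) = walk_weight w (v # vs) + w ?l v"
    using 1 by (force simp del: last.simps)
  have u: "u \<notin> ?A" and l: "?l \<in> ?A" and ul: "u \<noteq> ?l" and Euv: "E u v"
    using 1(3,5) last_in_set[of "v # vs"] by auto
  \<comment> \<open>Prepending \<open>u\<close> reroutes the closing edge: \<open>?l\<close> now
    goes to \<open>u\<close>, and \<open>u\<close> to \<open>v\<close>. Only these two values
    change.\<close>
  define \<rho> where "\<rho> = \<pi>(?l := u, u := v)"
  have agree: "\<rho> z = \<pi> z" if "z \<in> ?A - {?l}" for z
    using that u by (auto simp: \<rho>_def)
  have v: "v \<in> ?A" by simp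
  have im: "\<pi> ` (?A - {?l}) = ?A - {v}" and inj: "inj_on \<pi> (?A - {?l})"
    using \<pi>(1,2) l inj_on_image_set_diff[of \<pi> ?A ?A "{?l}"]
    by (auto simp: bij_betw_def inj_on_diff simp del: set_simps last.simps)
  have bij0: "bij_betw \<rho> (?A - {?l}) (?A - {v})"
    using im inj agree by (metis bij_betw_cong bij_betw_imageI)
  have bij: "bij_betw \<rho> (insert u ?A) (insert u ?A)"
  proof -
    have "bij_betw \<rho> {?l, u} {u, v}"
      using ul u by (auto simp: \<rho>_def bij_betw_def inj_on_def)
    then have "bij_betw \<rho> ((?A - {?l}) \<union> {?l, u}) ((?A - {v}) \<union> {u, v})"
      using bij0 u by (intro bij_betw_combine) auto
    moreover have "(?A - {?l}) \<union> {?l, u} = insert u ?A" "(?A - {v}) \<union> {u, v} = insert u ?A"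
      using l v by blast+
    ultimately show ?thesis by (simp only:)
  qed
  have "(\<Sum>z\<in>insert u ?A. w z (\<rho> z)) = w u v + (\<Sum>z\<in>?A. w z (\<rho> z))"
    using u by (subst sum.insert) (auto simp: \<rho>_def simp del: set_simps last.simps)
  also have "(\<Sum>z\<in>?A. w z (\<rho> z)) = w ?l u + (\<Sum>z\<in>?A - {?l}. w z (\<rho> z))"
    using l ul by (subst sum.remove[of _ ?l]) (auto simp: \<rho>_def simp del: set_simps last.simps)
  also have "(\<Sum>z\<in>?A - {?l}. w z (\<rho> z)) = (\<Sum>z\<in>?A - {?l}. w z (\<pi> z))"
    using agree by (intro sum.cong) (auto simp del: set_simps last.simps)
  also have "\<dots> = walk_weight w (v # vs)"
    using \<pi>(2,4) l by (subst (asm) sum.remove[of _ ?l]) (auto simp del: set_simps last.simps)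
  finally have sum: "(\<Sum>z\<in>insert u ?A. w z (\<rho> z)) = w u v + (w ?l u + walk_weight w (v # vs))" .
  show ?case
  proof (rule 1(2))
    show "bij_betw \<rho> (set (u # v # vs)) (set (u # v # vs))" using bij by simp
    show "\<rho> (last (u # v # vs)) = hd (u # v # vs)" using ul by (simp add: \<rho>_def)
    show "E z (\<rho> z)" if "z \<in> set (u # v # vs)" "z \<noteq> last (u # v # vs)" for z
    proof (cases "z = u")
      case True then show ?thesis using Euv by (simp add: \<rho>_def)
    next
      case False
      then have "z \<in> ?A" "z \<noteq> ?l" using that by auto
      then show ?thesis using agree \<pi>(3) by (metis Diff_iff singletonD)
    qed
    show "(\<Sum>z\<in>set (u # v # vs). w z (\<rho> z))
      = walk_weight w (u # v # vs) + w (last (u # v # vs)) (hd (u # v # vs))"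
      using sum by simp
  qed
next
  case ("2_2" w v)
  then show ?case by (auto intro: "2_2"(1)[of id])
qed simp

text \<open>The potential of \<open>v\<close> is the largest weight of a simple walk ending at
  \<open>v\<close>, from any start. The hypothesis speaks of permutations along edges rather than of
  cycles, since these are what splits into partial bijections later.\<close>

lemma potential_exists:
  fixes w :: "'v::finite \<Rightarrow> 'v \<Rightarrow> real"
  assumes nonpos: "\<And>V \<pi>. bij_betw \<pi> V V \<Longrightarrow> (\<And>v. v \<in> V \<Longrightarrow> E v (\<pi> v)) \<Longrightarrow> (\<Sum>v\<in>V. w v (\<pi> v)) \<le> 0"
  obtains x where "\<And>u v. E u v \<Longrightarrow> x u + w u v \<le> x v"
proof -
  define P where "P v = {vs. distinct vs \<and> vs \<noteq> [] \<and> successively E vs \<and> last vs = v}" for v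
  have "finite {vs :: 'v list. distinct vs}"
    using finite_subset_distinct[of "UNIV :: 'v set"] by simp
  then have fin: "finite (P v)" for v
    by (rule finite_subset[rotated]) (auto simp: P_def)
  have ne: "[v] \<in> P v" for v by (simp add: P_def)
  define x where "x v = Max (walk_weight w ` P v)" for v
  have le_x: "walk_weight w vs \<le> x v" if "vs \<in> P v" for vs v
    using that fin by (auto simp: x_def)
  have "x u + w u v \<le> x v" if E: "E u v" for u v
  proof -
    have "x u \<in> walk_weight w ` P u"
      unfolding x_def using fin ne by (intro Max_in) auto
    then obtain vs where vs: "vs \<in> P u" and xu: "x u = walk_weight w vs" by blast
    show ?thesis
    proof (cases "v \<in> set vs")
      case False
      obtain us where us: "vs = us @ [u]"
        using vs unfolding P_def by (metis (mono_tags, lifting) append_butlast_last_id mem_Collect_eq)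
      have "vs @ [v] \<in> P v"
        using vs False E by (auto simp: P_def successively_append_iff)
      moreover have "walk_weight w (vs @ [v]) = walk_weight w vs + w u v"
        using walk_weight_append[of w us u "[v]"] us by simp
      ultimately show ?thesis using le_x xu by metis
    next
      case True
      \<comment> \<open>The best walk to \<open>u\<close> already visits \<open>v\<close>: its part
        up to \<open>v\<close> competes for \<open>x v\<close>, and the rest is closed by the edge
        from \<open>u\<close> to \<open>v\<close> into a cycle of weight at most 0.\<close>
      then obtain us zs where split: "vs = us @ v # zs" by (meson split_list)
      have "us @ [v] \<in> P v"
        using vs by (auto simp: P_def split successively_append_iff)
      then have *: "walk_weight w (us @ [v]) \<le> x v" by (rule le_x)
      have l: "last (v # zs) = u" using vs by (simp add: P_def split)
      have "distinct (v # zs)" "v # zs \<noteq> []" "successively E (v # zs)"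
        using vs by (auto simp: P_def split successively_append_iff)
      then obtain \<pi> where \<pi>: "bij_betw \<pi> (set (v # zs)) (set (v # zs))" "\<pi> u = v"
        "\<And>z. z \<in> set (v # zs) \<Longrightarrow> z \<noteq> u \<Longrightarrow> E z (\<pi> z)"
        "(\<Sum>z\<in>set (v # zs). w z (\<pi> z)) = walk_weight w (v # zs) + w u v"
        by (rule cycle_permutation[where w = w]) (rule that, simp_all only: l list.sel)
      have "(\<Sum>z\<in>set (v # zs). w z (\<pi> z)) \<le> 0"
        using \<pi>(1-3) E by (intro nonpos) metis+
      then show ?thesis
        using * \<pi>(4) xu walk_weight_append[of w us v zs, folded split] by linarith
    qed
  qed
  then show thesis by (rule that)
qed

subsection \<open>Types and partial bijections\<close>

lemma type_of_iff:
  "type_of M x $ i $ j \<longleftrightarrow> (\<forall>k. x $ i - M $ i $ j \<le> x $ k - M $ k $ j)"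
proof -
  have "x $ i - M $ i $ j = (MIN k. x $ k - M $ k $ j) \<longleftrightarrow>
      (\<forall>k. x $ i - M $ i $ j \<le> x $ k - M $ k $ j)"
    by (subst eq_commute, subst Max_eq_iff Min_eq_iff) auto
  then show ?thesis by (simp add: type_of_def Dom_def column_def)
qed

lemma contains_pb_iff: "contains_pb S \<sigma> \<longleftrightarrow> (\<forall>i j. \<sigma> j = Some i \<longrightarrow> S $ i $ j)"
  by (auto simp: contains_pb_def pb_matrix_def less_eq_vec_def)

lemma contains_pb_iff_the: "contains_pb S \<sigma> \<longleftrightarrow> (\<forall>j\<in>dom \<sigma>. S $ the (\<sigma> j) $ j)"
  by (force simp: contains_pb_iff)

lemma partial_bijection_bij_betw:
  assumes "partial_bijection \<sigma>"
  shows "bij_betw (\<lambda>j. the (\<sigma> j)) (dom \<sigma>) (ran \<sigma>)"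
proof (rule bij_betw_imageI)
  show "inj_on (\<lambda>j. the (\<sigma> j)) (dom \<sigma>)"
    using assms unfolding partial_bijection_def inj_on_def by (metis domD option.sel)
  show "(\<lambda>j. the (\<sigma> j)) ` dom \<sigma> = ran \<sigma>"
    by (force simp: ran_def)
qed

text \<open>The arguments below use total functions on a set of columns; this converts them to the
  partial maps of the theorem.\<close>

definition pb_of :: "'d set \<Rightarrow> ('d \<Rightarrow> 'n) \<Rightarrow> ('d \<rightharpoonup> 'n)" where
  "pb_of J f = (\<lambda>j. if j \<in> J then Some (f j) else None)"

lemma dom_pb_of [simp]: "dom (pb_of J f) = J"
  by (auto simp: pb_of_def dom_def)

lemma ran_pb_of [simp]: "ran (pb_of J f) = f ` J"
  by (auto simp: pb_of_def ran_def)

lemma the_pb_of [simp]: "j \<in> J \<Longrightarrow> the (pb_of J f j) = f j"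
  by (simp add: pb_of_def)

lemma partial_bijection_pb_of: "inj_on f J \<Longrightarrow> partial_bijection (pb_of J f)"
  by (auto simp: partial_bijection_def inj_on_def pb_of_def)

lemma permanent_attaining_pb_of:
  "permanent_attaining M (pb_of J f) \<longleftrightarrow>
    (\<forall>g. bij_betw g J (f ` J) \<longrightarrow> (\<Sum>j\<in>J. M $ g j $ j) \<le> (\<Sum>j\<in>J. M $ f j $ j))"
  by (simp add: permanent_attaining_def)

text \<open>In each column \<open>f j\<close> attains the minimum, so passing to \<open>g j\<close>
  costs \<open>?d j\<close>, which is nonnegative. As \<open>f\<close> and \<open>g\<close> have the
  same image, the coordinates of \<open>x\<close> cancel in the total cost. Total cost 0 forces
  every \<open>?d j\<close> to vanish, so \<open>g j\<close> attains the minimum too.\<close>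

lemma sum_le_of_type:
  assumes S: "S = type_of M x" and f: "bij_betw f J I" and g: "bij_betw g J I"
    and fS: "\<And>j. j \<in> J \<Longrightarrow> S $ f j $ j"
  shows "(\<Sum>j\<in>J. M $ g j $ j) \<le> (\<Sum>j\<in>J. M $ f j $ j)"
    and "(\<Sum>j\<in>J. M $ f j $ j) \<le> (\<Sum>j\<in>J. M $ g j $ j) \<Longrightarrow> j \<in> J \<Longrightarrow> S $ g j $ j"
proof -
  let ?d = "\<lambda>j. (x $ g j - M $ g j $ j) - (x $ f j - M $ f j $ j)"
  have nonneg: "0 \<le> ?d j" if "j \<in> J" for j
    using fS[OF that] by (auto simp: S type_of_iff)
  have "(\<Sum>j\<in>J. x $ g j) = (\<Sum>j\<in>J. x $ f j)"
    using sum.reindex_bij_betw[OF f, of "($) x"] sum.reindex_bij_betw[OF g, of "($) x"] by simp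
  then have eq: "sum ?d J = (\<Sum>j\<in>J. M $ f j $ j) - (\<Sum>j\<in>J. M $ g j $ j)"
    by (simp add: sum_subtractf)
  then show "(\<Sum>j\<in>J. M $ g j $ j) \<le> (\<Sum>j\<in>J. M $ f j $ j)"
    using sum_nonneg[of J ?d] nonneg by simp
  assume "(\<Sum>j\<in>J. M $ f j $ j) \<le> (\<Sum>j\<in>J. M $ g j $ j)" and j: "j \<in> J"
  then have "sum ?d J = 0" using eq sum_nonneg[of J ?d] nonneg by simp
  then have "?d j = 0"
    using nonneg j by (subst (asm) sum_nonneg_eq_0_iff) auto
  then show "S $ g j $ j"
    using fS[OF j] by (simp add: S type_of_iff)
qed

text \<open>The hypotheses are (T1) to (T3) for total functions. Given \<open>le\<close>, being
  permanent-attaining amounts for \<open>g\<close> to having the same sum as \<open>f\<close>,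
  whence the form of \<open>eq\<close>.\<close>

lemma type_exists:
  fixes M :: "real ^ 'd ^ 'n" and S :: "bool ^ 'd ^ 'n"
  assumes col: "\<And>j. \<exists>i. S $ i $ j"
    and le: "\<And>J f g. inj_on f J \<Longrightarrow> bij_betw g J (f ` J) \<Longrightarrow> (\<And>j. j \<in> J \<Longrightarrow> S $ f j $ j) \<Longrightarrow>
      (\<Sum>j\<in>J. M $ g j $ j) \<le> (\<Sum>j\<in>J. M $ f j $ j)"
    and eq: "\<And>J f g j. inj_on f J \<Longrightarrow> bij_betw g J (f ` J) \<Longrightarrow> (\<And>j. j \<in> J \<Longrightarrow> S $ f j $ j) \<Longrightarrow>
      (\<Sum>j\<in>J. M $ g j $ j) = (\<Sum>j\<in>J. M $ f j $ j) \<Longrightarrow> j \<in> J \<Longrightarrow> S $ g j $ j"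
  shows "\<exists>x. S = type_of M x"
proof -
  \<comment> \<open>\<open>e * c i j\<close> is the slack: positive exactly outside \<open>S\<close>
    once \<open>e\<close> is.\<close>
  define c where "c i j = (if S $ i $ j then 0 else 1 :: real)" for i j
  \<comment> \<open>The constraints to be met by \<open>e\<close>, one per triple; there are
    finitely many, so one small \<open>e\<close> serves all.\<close>
  define T where "T = {(J, f, g). inj_on f J \<and> bij_betw g J (f ` J) \<and> (\<forall>j\<in>J. S $ f j $ j)}"
  have "\<forall>\<^sub>F e in at_right 0. \<forall>(J, f, g)\<in>T. (\<Sum>j\<in>J. M $ g j $ j + e * c (g j) j) \<le> (\<Sum>j\<in>J. M $ f j $ j)"
  proof (intro eventually_ball_finite ballI)
    show "finite T" by simp
  next
    fix t assume "t \<in> T"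
    then obtain J f g where t: "t = (J, f, g)" and fg: "inj_on f J" "bij_betw g J (f ` J)"
      and fS: "\<And>j. j \<in> J \<Longrightarrow> S $ f j $ j" by (auto simp: T_def)
    let ?A = "\<Sum>j\<in>J. M $ g j $ j" and ?B = "\<Sum>j\<in>J. M $ f j $ j"
    show "\<forall>\<^sub>F e in at_right 0. case t of (J, f, g) \<Rightarrow>
        (\<Sum>j\<in>J. M $ g j $ j + e * c (g j) j) \<le> (\<Sum>j\<in>J. M $ f j $ j)"
    proof (cases "?A = ?B")
      \<comment> \<open>On a tie, \<open>eq\<close> places all of \<open>g\<close> inside
        \<open>S\<close>, so no slack is added. Otherwise the gap is strict and absorbs a small
        slack.\<close>
      case True
      then have "(\<Sum>j\<in>J. M $ g j $ j + e * c (g j) j) = ?B" for e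
        using eq[OF fg fS] by (subst True[symmetric], intro sum.cong) (auto simp: c_def)
      then show ?thesis by (simp add: t)
    next
      case False
      then have "?A < ?B" using le[OF fg fS] by fastforce
      moreover have "((\<lambda>e. ?A + e * (\<Sum>j\<in>J. c (g j) j)) \<longlongrightarrow> ?A + 0 * (\<Sum>j\<in>J. c (g j) j)) (at_right 0)"
        by (intro tendsto_intros)
      ultimately have "\<forall>\<^sub>F e in at_right 0. ?A + e * (\<Sum>j\<in>J. c (g j) j) < ?B"
        by (intro order_tendstoD(2)) auto
      then show ?thesis
        by (rule eventually_mono) (simp add: t sum.distrib sum_distrib_left)
    qed
  qed
  then have "\<forall>\<^sub>F e in at_right 0. 0 < e \<and>
      (\<forall>(J, f, g)\<in>T. (\<Sum>j\<in>J. M $ g j $ j + e * c (g j) j) \<le> (\<Sum>j\<in>J. M $ f j $ j))"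
    using eventually_at_right_less by (rule eventually_conj[rotated])
  then obtain e where e: "0 < e" and
    T': "\<forall>(J, f, g)\<in>T. (\<Sum>j\<in>J. M $ g j $ j + e * c (g j) j) \<le> (\<Sum>j\<in>J. M $ f j $ j)"
    by (elim eventually_happens'[OF trivial_limit_at_right_real, THEN exE] conjE) (rule that)
  have T: "(\<Sum>j\<in>J. M $ g j $ j + e * c (g j) j) \<le> (\<Sum>j\<in>J. M $ f j $ j)" if "(J, f, g) \<in> T" for J f g
    using bspec[OF T' that] by simp

  \<comment> \<open>Rows are \<open>Inl\<close>, columns \<open>Inr\<close>. For a potential
    \<open>p\<close>, the edges from column \<open>j\<close> to row \<open>i\<close> say that
    \<open>p (Inl i) - M $ i $ j\<close> is at least \<open>p (Inr j)\<close> plus slack; the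
    reverse edges, present on \<open>S\<close>, bound it above by \<open>p (Inr j)\<close>.\<close>
  define E :: "'n + 'd \<Rightarrow> 'n + 'd \<Rightarrow> bool" where
    "E u v = (case (u, v) of (Inl i, Inr j) \<Rightarrow> S $ i $ j | (Inr j, Inl i) \<Rightarrow> True | _ \<Rightarrow> False)" for u v
  define w :: "'n + 'd \<Rightarrow> 'n + 'd \<Rightarrow> real" where
    "w u v = (case (u, v) of (Inl i, Inr j) \<Rightarrow> - M $ i $ j
      | (Inr j, Inl i) \<Rightarrow> M $ i $ j + e * c i j | _ \<Rightarrow> 0)" for u v
  have nonpos: "(\<Sum>v\<in>V. w v (\<pi> v)) \<le> 0" if bij: "bij_betw \<pi> V V" and E: "\<And>v. v \<in> V \<Longrightarrow> E v (\<pi> v)"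
    for V \<pi>
  proof -
    define I J where "I = Inl -` V" and "J = Inr -` V"
    have V: "V = Inl ` I \<union> Inr ` J"
      unfolding I_def J_def by (auto simp: image_iff) (metis sum.exhaust)
    \<comment> \<open>Edges only join rows to columns and back, so \<open>\<pi>\<close> splits into
      \<open>g\<close> from columns to rows and \<open>h\<close> from rows to columns.\<close>
    define g where "g j = projl (\<pi> (Inr j))" for j
    define h where "h i = projr (\<pi> (Inl i))" for i
    have g: "\<pi> (Inr j) = Inl (g j)" if "j \<in> J" for j
      using E[of "Inr j"] that by (auto simp: J_def g_def E_def split: sum.splits)
    have h: "\<pi> (Inl i) = Inr (h i)" "S $ i $ h i" if "i \<in> I" for i
      using E[of "Inl i"] that by (auto simp: I_def h_def E_def split: sum.splits)
    have inj: "inj_on \<pi> V" and im: "\<pi> ` V = V" using bij by (auto simp: bij_betw_def)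
    have "Inl ` (g ` J) \<union> Inr ` (h ` I) = Inl ` I \<union> Inr ` J"
    proof -
      have "\<pi> ` (Inl ` I) = Inr ` (h ` I)" "\<pi> ` (Inr ` J) = Inl ` (g ` J)"
        unfolding image_image using g h(1) by (intro image_cong; simp)+
      then show ?thesis using im unfolding V image_Un by (simp only: Un_commute)
    qed
    moreover have "Inl -` (Inl ` A \<union> Inr ` B) = A" "Inr -` (Inl ` A \<union> Inr ` B) = B"
      for A :: "'n set" and B :: "'d set" by auto
    ultimately have gJ: "g ` J = I" and hI: "h ` I = J" by metis+
    have "inj_on g J"
    proof (rule inj_onI)
      fix j k assume "j \<in> J" "k \<in> J" "g j = g k"
      then have "(Inr j :: 'n + 'd) = Inr k"
        using g by (subst inj_on_eq_iff[OF inj, symmetric]) (auto simp: V)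
      then show "j = k" by simp
    qed
    then have g_bij: "bij_betw g J I" using gJ by (rule bij_betw_imageI)
    have "inj_on h I"
    proof (rule inj_onI)
      fix i k assume "i \<in> I" "k \<in> I" "h i = h k"
      then have "(Inl i :: 'n + 'd) = Inl k"
        using h(1) by (subst inj_on_eq_iff[OF inj, symmetric]) (auto simp: V)
      then show "i = k" by simp
    qed
    then have hbij: "bij_betw h I J" using hI by (rule bij_betw_imageI)
    \<comment> \<open>Inverting \<open>h\<close> gives a bijection contained in \<open>S\<close>
      with the same domain and image as \<open>g\<close>.\<close>
    define f where "f = the_inv_into I h"
    have f: "bij_betw f J I" unfolding f_def using hbij by (rule bij_betw_the_inv_into)
    have hf: "h (f j) = j" if "j \<in> J" for j
      unfolding f_def using hbij that by (rule f_the_inv_into_f_bij_betw)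
    have fS: "S $ f j $ j" if "j \<in> J" for j
      using h(2)[of "f j"] hf[OF that] bij_betwE[OF f] that by simp
    have "(J, f, g) \<in> T"
      using f g_bij fS by (simp add: T_def bij_betw_def)
    note T[OF this]
    moreover have "(\<Sum>i\<in>I. M $ i $ h i) = (\<Sum>j\<in>J. M $ f j $ j)"
      using sum.reindex_bij_betw[OF f, of "\<lambda>i. M $ i $ h i"] hf by simp
    moreover have "(\<Sum>v\<in>V. w v (\<pi> v)) = (\<Sum>i\<in>I. w (Inl i) (\<pi> (Inl i))) + (\<Sum>j\<in>J. w (Inr j) (\<pi> (Inr j)))"
      unfolding V by (subst sum.union_disjoint) (auto simp: sum.reindex)
    moreover have "(\<Sum>i\<in>I. w (Inl i) (\<pi> (Inl i))) = - (\<Sum>i\<in>I. M $ i $ h i)"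
      using h(1) by (simp add: w_def sum_negf)
    moreover have "(\<Sum>j\<in>J. w (Inr j) (\<pi> (Inr j))) = (\<Sum>j\<in>J. M $ g j $ j + e * c (g j) j)"
      using g by (simp add: w_def)
    ultimately show ?thesis by linarith
  qed
  obtain p where p: "\<And>u v. E u v \<Longrightarrow> p u + w u v \<le> p v"
    using potential_exists[of E w] nonpos by blast
  define x :: "real ^ 'n" where "x = (\<chi> i. p (Inl i))"
  have ge: "p (Inr j) + e * c i j \<le> x $ i - M $ i $ j" for i j
    using p[of "Inr j" "Inl i"] by (simp add: E_def w_def x_def)
  have le': "x $ i - M $ i $ j \<le> p (Inr j)" if "S $ i $ j" for i j
    using p[of "Inl i" "Inr j"] that by (simp add: E_def w_def x_def)
  have "S $ i $ j \<longleftrightarrow> type_of M x $ i $ j" for i j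
  proof
    assume S: "S $ i $ j"
    show "type_of M x $ i $ j"
      unfolding type_of_iff
    proof
      fix k
      have "0 \<le> e * c k j" using e by (simp add: c_def)
      then show "x $ i - M $ i $ j \<le> x $ k - M $ k $ j"
        using ge[of j k] le'[OF S] by linarith
    qed
  next
    assume t: "type_of M x $ i $ j"
    \<comment> \<open>By (T1) the minimum of column \<open>j\<close> is at most
      \<open>p (Inr j)\<close>, leaving no room for slack at a minimizing row.\<close>
    obtain k where "S $ k $ j" using col by blast
    then have "x $ i - M $ i $ j \<le> p (Inr j)"
      using t order_trans le' unfolding type_of_iff by blast
    then have "e * c i j \<le> 0" using ge[of j i] by linarith
    then show "S $ i $ j" using e by (auto simp: c_def split: if_splits)
  qed
  then have "S = type_of M x" by (simp add: vec_eq_iff)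
  then show ?thesis ..
qed

theorem theorem6p1:
  fixes M :: "real ^ 'd ^ 'n" and S :: "bool ^ 'd ^ 'n"
  shows "(\<exists>x :: real ^ 'n. S = type_of M x) \<longleftrightarrow>
    (\<forall>j. \<exists>i. S $ i $ j) \<and>
    (\<forall>\<sigma>. partial_bijection \<sigma> \<and> contains_pb S \<sigma> \<longrightarrow> permanent_attaining M \<sigma>) \<and>
    (\<forall>\<sigma>. partial_bijection \<sigma> \<and> contains_pb S \<sigma> \<longrightarrow>
      (\<forall>\<tau>. partial_bijection \<tau> \<and> permanent_attaining M \<tau> \<and> dom \<tau> = dom \<sigma> \<and> ran \<tau> = ran \<sigma>
        \<longrightarrow> contains_pb S \<tau>))"
    (is "?type \<longleftrightarrow> ?T1 \<and> ?T2 \<and> ?T3")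
proof (intro iffI conjI)
  assume ?type
  then obtain x where S: "S = type_of M x" ..
  show ?T1
  proof
    fix j
    have "(MIN k. x $ k - M $ k $ j) \<in> range (\<lambda>k. x $ k - M $ k $ j)"
      by (intro Min_in) auto
    then obtain i where "(MIN k. x $ k - M $ k $ j) = x $ i - M $ i $ j" by blast
    then have "S $ i $ j" by (simp add: S type_of_def Dom_def column_def)
    then show "\<exists>i. S $ i $ j" ..
  qed
  show ?T2
    unfolding permanent_attaining_def
    using sum_le_of_type(1)[OF S partial_bijection_bij_betw] by (auto simp: contains_pb_iff_the)
  show ?T3
  proof (intro allI impI, elim conjE)
    fix \<sigma> \<tau> :: "'d \<rightharpoonup> 'n"
    assume \<sigma>: "partial_bijection \<sigma>" "contains_pb S \<sigma>"
      and \<tau>: "partial_bijection \<tau>" "permanent_attaining M \<tau>" "dom \<tau> = dom \<sigma>" "ran \<tau> = ran \<sigma>"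
    have f: "bij_betw (\<lambda>j. the (\<sigma> j)) (dom \<sigma>) (ran \<sigma>)"
      and g: "bij_betw (\<lambda>j. the (\<tau> j)) (dom \<sigma>) (ran \<sigma>)"
      using partial_bijection_bij_betw \<sigma>(1) \<tau>(1,3,4) by metis+
    \<comment> \<open>Here \<open>\<sigma>\<close> is the competitor against which
      \<open>\<tau>\<close> is maximal.\<close>
    have "(\<Sum>j\<in>dom \<sigma>. M $ the (\<sigma> j) $ j) \<le> (\<Sum>j\<in>dom \<sigma>. M $ the (\<tau> j) $ j)"
      using \<tau>(2) f unfolding permanent_attaining_def \<tau>(3,4) by blast
    then show "contains_pb S \<tau>"
      using sum_le_of_type(2)[OF S f g] \<sigma>(2) by (simp add: contains_pb_iff_the \<tau>(3))
  qed
next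
  assume "?T1 \<and> ?T2 \<and> ?T3"
  then have T1: ?T1 and T2: ?T2 and T3: ?T3 by blast+
  have le: "(\<Sum>j\<in>J. M $ g j $ j) \<le> (\<Sum>j\<in>J. M $ f j $ j)"
    if "inj_on f J" "bij_betw g J (f ` J)" "\<And>j. j \<in> J \<Longrightarrow> S $ f j $ j" for J f g
  proof -
    have "permanent_attaining M (pb_of J f)"
      using T2 that by (simp add: partial_bijection_pb_of contains_pb_iff_the)
    then show ?thesis using that(2) by (simp add: permanent_attaining_pb_of)
  qed
  show ?type
  proof (rule type_exists[OF _ le])
    show "\<exists>i. S $ i $ j" for j using T1 by blast
    fix J f g j
    assume f: "inj_on f J" and g: "bij_betw g J (f ` J)" and fS: "\<And>j. j \<in> J \<Longrightarrow> S $ f j $ j"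
      and eq: "(\<Sum>j\<in>J. M $ g j $ j) = (\<Sum>j\<in>J. M $ f j $ j)" and j: "j \<in> J"
    have gJ: "g ` J = f ` J" using g by (simp add: bij_betw_def)
    \<comment> \<open>\<open>g\<close> ties with \<open>f\<close>, which is maximal by
      \<open>le\<close>.\<close>
    have "permanent_attaining M (pb_of J g)"
      unfolding permanent_attaining_pb_of gJ eq using le f fS by blast
    moreover have "partial_bijection (pb_of J g)"
      using g by (simp add: partial_bijection_pb_of bij_betw_def)
    ultimately have "contains_pb S (pb_of J g)"
      using T3[rule_format, of "pb_of J f" "pb_of J g"] f fS gJ
      by (simp add: partial_bijection_pb_of contains_pb_iff_the)
    then show "S $ g j $ j" using j by (simp add: contains_pb_iff_the)
  qed
qed

end
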